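(* For every positive integer $n$ and every integer $k$ with $n \le 2^k$, \[ \tilde{F}\!\left(\frac{n}{2^k}\right) \;=\; \frac{n k - 2B(n)}{2^k}. \]
   Context: For a real number $x$, $\mathrm{Zigzag}(x) = \min\left(x - \lfloor x \rfloor,\ \lceil x \rceil - x\right)$. The function $\tilde{F}:\mathbb{R}\to\mathbb{R}$ (the Blancmange/Takagi function) is $\tilde{F}(x) = \sum_{i=0}^{\infty} 2^{-i}\, \mathrm{Zigzag}(2^i x)$. $B$ is the function on positive integers defined by $B(1) = 0$ and, for $n \ge 2$, $B(n) = \lfloor n/2 \rfloor + B(\lfloor n/2 \rfloor) + B(\lceil n/2 \rceil)$ (the minimum number of key comparisons of MergeSort on $n$ elements). *)

theory Defs
  imports Complex_Main
begin

definition zigzag :: "real \<Rightarrow> real" where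
  "zigzag x = min (x - of_int \<lfloor>x\<rfloor>) (of_int \<lceil>x\<rceil> - x)"

definition blancmange :: "real \<Rightarrow> real" where
  "blancmange x = (\<Sum>i. zigzag (2 ^ i * x) / 2 ^ i)"

lemma zigzag_bounds: "0 \<le> zigzag x" "zigzag x \<le> 1"
  unfolding zigzag_def by linarith+

text \<open>The series converges at every point, so \<^const>\<open>suminf\<close> denotes its actual sum.\<close>

lemma summable_blancmange: "summable (\<lambda>i. zigzag (2 ^ i * x) / 2 ^ i)"
proof (rule summable_comparison_test')
  show "summable (\<lambda>i. (1 / 2 :: real) ^ i)"
    by (rule summable_geometric) simp
  show "norm (zigzag (2 ^ i * x) / 2 ^ i) \<le> (1 / 2) ^ i" if "0 \<le> i" for i
    using zigzag_bounds[of "2 ^ i * x"] by (simp add: power_one_over divide_simps)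
qed

text \<open>
  The rounded-up half of \<open>n\<close> is \<open>(n + 1) div 2\<close>. The value at 0 lies outside the
  intended domain, the positive integers, and is never used by the recursion for \<open>n \<ge> 1\<close>.
\<close>

fun B :: "nat \<Rightarrow> nat" where
  "B n = (if n \<le> 1 then 0 else n div 2 + B (n div 2) + B ((n + 1) div 2))"

declare B.simps [simp del]

end

theory Submission
  imports Defs
begin

text \<open>
  Both sides satisfy the same recursion in \<open>k\<close>. On the analytic side it comes from
  \<open>blancmange x = zigzag x + blancmange (2 * x) / 2\<close> together with 1-periodicity, applied to
  the two halves of the unit interval. On the combinatorial side it amounts to the identity
  \<open>2 * B (2 ^ k + m) = 2 * m + k * 2 ^ k + 2 * B m\<close> for \<open>m \<le> 2 ^ k\<close>: adding \<open>2 ^ k\<close> to the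
  argument of \<open>B\<close> has a closed-form cost.
\<close>

lemma zigzag_add_of_int: "zigzag (x + of_int z) = zigzag x"
  by (simp add: zigzag_def)

lemma zigzag_lower_half:
  assumes "0 \<le> x" "x \<le> 1 / 2"
  shows "zigzag x = x"
\<comment> \<open>At \<open>0\<close> the ceiling is 0 instead of 1, so this endpoint is
  separate.\<close>
proof (cases "x = 0")
  case False
  with assms have "\<lfloor>x\<rfloor> = 0" "\<lceil>x\<rceil> = 1"
    by (auto simp: floor_eq_iff ceiling_eq_iff)
  with assms show ?thesis
    by (simp add: zigzag_def)
qed (simp add: zigzag_def)

lemma zigzag_upper_half:
  assumes "1 / 2 \<le> x" "x \<le> 1"
  shows "zigzag x = 1 - x"
proof (cases "x = 1")
  case False
  with assms have "\<lfloor>x\<rfloor> = 0" "\<lceil>x\<rceil> = 1"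
    by (auto simp: floor_eq_iff ceiling_eq_iff)
  with assms show ?thesis
    by (simp add: zigzag_def)
qed (simp add: zigzag_def)

text \<open>Split off the term at index 0; reindexing turns the tail into half the series at
  \<open>2 * x\<close>.\<close>

lemma blancmange_rec: "blancmange x = zigzag x + blancmange (2 * x) / 2"
proof -
  have "blancmange x = zigzag x + (\<Sum>i. zigzag (2 ^ Suc i * x) / 2 ^ Suc i)"
    unfolding blancmange_def using suminf_split_head[OF summable_blancmange[of x]] by simp
  also have "(\<lambda>i. zigzag (2 ^ Suc i * x) / 2 ^ Suc i) = (\<lambda>i. zigzag (2 ^ i * (2 * x)) / 2 ^ i / 2)"
    by (simp add: field_simps)
  also have "(\<Sum>i. zigzag (2 ^ i * (2 * x)) / 2 ^ i / 2) = blancmange (2 * x) / 2"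
    unfolding blancmange_def by (rule suminf_divide[OF summable_blancmange])
  finally show ?thesis .
qed

lemma blancmange_add_one: "blancmange (x + 1) = blancmange x"
proof -
  have "zigzag (2 ^ i * (x + 1)) = zigzag (2 ^ i * x)" for i
    using zigzag_add_of_int[of "2 ^ i * x" "2 ^ i"] by (simp add: distrib_left)
  then show ?thesis
    by (simp add: blancmange_def)
qed

lemma blancmange_0: "blancmange 0 = 0"
  by (simp add: blancmange_def zigzag_def)

text \<open>At 0 and 1 both sides vanish, so the recursion can be unfolded without a guard.\<close>

lemma B_rec: "B n = n div 2 + B (n div 2) + B ((n + 1) div 2)"
proof (cases "n \<le> 1")
  case True
  then have "n = 0 \<or> n = 1" by auto
  moreover have "B 0 = 0" "B 1 = 0" by (simp_all add: B.simps)
  ultimately show ?thesis by auto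
qed (subst B.simps, simp)

text \<open>Since \<open>2 ^ Suc k\<close> is even, halving \<open>2 ^ Suc k + m\<close> adds
  \<open>2 ^ k\<close> to each rounded half of \<open>m\<close>. The induction hypothesis applies to
  both halves, and the recursion for \<open>B m\<close> reassembles the rest.\<close>

lemma B_power_2_add:
  assumes "m \<le> 2 ^ k"
  shows "2 * B (2 ^ k + m) = 2 * m + k * 2 ^ k + 2 * B m"
  using assms
proof (induction k arbitrary: m)
  case 0
  then have "m = 0 \<or> m = 1" by auto
  moreover have "B 0 = 0" "B 1 = 0" "B 2 = 1"
    using B_rec[of 2] by (simp_all add: B.simps)
  ultimately show ?case by (auto simp: numeral_2_eq_2)
next
  case (Suc k)
  have halves: "m div 2 \<le> 2 ^ k" "(m + 1) div 2 \<le> 2 ^ k"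
    using Suc.prems by auto
  have "B (2 ^ Suc k + m) = 2 ^ k + m div 2 + B (2 ^ k + m div 2) + B (2 ^ k + (m + 1) div 2)"
    using B_rec[of "2 ^ Suc k + m"] div_mult_self2[of 2 m "2 ^ k"] div_mult_self2[of 2 "m + 1" "2 ^ k"]
    by (simp add: ac_simps)
  moreover have "m div 2 + (m + 1) div 2 = m"
    by presburger
  ultimately show ?case
    using Suc.IH[OF halves(1)] Suc.IH[OF halves(2)] B_rec[of m]
    by (simp add: algebra_simps)
qed

lemma blancmange_dyadic:
  assumes "n \<le> 2 ^ k"
  shows "blancmange (real n / 2 ^ k) = (real n * real k - 2 * real (B n)) / 2 ^ k"
  using assms
proof (induction k arbitrary: n)
  case 0
  then have "n = 0 \<or> n = 1" by auto
  moreover have "B 0 = 0" "B 1 = 0" by (simp_all add: B.simps)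
  ultimately show ?case
    using blancmange_add_one[of 0] by (auto simp: blancmange_0)
next
  case (Suc k)
  let ?x = "real n / 2 ^ Suc k"
  have double: "2 * ?x = real n / 2 ^ k"
    by simp
  show ?case
  proof (cases "n \<le> 2 ^ k")
    \<comment> \<open>Here \<open>?x\<close> is at most 1/2: the zigzag term adds \<open>n\<close>
      to the numerator, turning \<open>n * k\<close> into \<open>n * (k + 1)\<close>.\<close>
    case True
    then have "real n \<le> 2 ^ k"
      by (simp add: of_nat_le_numeral_power_cancel_iff)
    then have "zigzag ?x = ?x"
      by (intro zigzag_lower_half) (auto simp: field_simps)
    then show ?thesis
      using blancmange_rec[of ?x] Suc.IH[OF True] unfolding double
      by (simp add: field_simps)
  next
    case False
    \<comment> \<open>Doubling takes \<open>?x\<close> beyond 1; periodicity brings it back to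
      \<open>m / 2 ^ k\<close>, where the induction hypothesis applies.\<close>
    define m where "m = n - 2 ^ k"
    have n: "n = 2 ^ k + m" and m: "m \<le> 2 ^ k"
      using False Suc.prems by (auto simp: m_def)
    have "real m \<le> 2 ^ k"
      using m by (simp add: of_nat_le_numeral_power_cancel_iff)
    then have "zigzag ?x = 1 - ?x"
      by (intro zigzag_upper_half) (auto simp: n field_simps)
    moreover have "blancmange (real n / 2 ^ k) = blancmange (real m / 2 ^ k)"
      using blancmange_add_one[of "real m / 2 ^ k"] by (simp add: n field_simps)
    moreover have "2 * real (B n) = 2 * real m + real k * 2 ^ k + 2 * real (B m)"
      using arg_cong[OF B_power_2_add[OF m], of real] by (simp add: n)
    ultimately have "2 * real (B n) = 2 * real m + real k * 2 ^ k + 2 * real (B m)"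
      and "blancmange ?x = (2 ^ Suc k - real n + real m * real k - 2 * real (B m)) / 2 ^ Suc k"
      using blancmange_rec[of ?x] Suc.IH[OF m] unfolding double
      by (simp_all add: add_divide_distrib diff_divide_distrib)
    moreover have "real n = 2 ^ k + real m"
      by (simp add: n)
    ultimately show ?thesis
      by (simp add: algebra_simps)
  qed
qed

theorem theorem4p1:
  fixes n :: nat and k :: int
  assumes "n \<ge> 1" and "real n \<le> 2 powi k"
  shows "blancmange (real n / 2 powi k) = (real n * of_int k - 2 * real (B n)) / 2 powi k"
proof -
  \<comment> \<open>A negative exponent would give \<open>2 powi k < 1\<close>, contradicting
    \<open>n \<ge> 1\<close>.\<close>
  have "k \<ge> 0"
  proof (rule ccontr)
    assume "\<not> k \<ge> 0"
    then have "(2::real) powi k < 2 powi 0"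
      by (intro power_int_strict_increasing) auto
    with assms show False by simp
  qed
  then obtain j where k: "k = int j"
    using nonneg_int_cases by blast
  have "n \<le> 2 ^ j"
    using assms(2) by (simp add: k of_nat_le_numeral_power_cancel_iff)
  from blancmange_dyadic[OF this] show ?thesis
    by (simp add: k)
qed

end
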